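(* For every hypergraph $H=(V_H,E_H,w_H)$ there exists a weighted $2$-graph $G_H=(V_{G_H},E_{G_H},w_{G_H})$ such that $H$ and $G_H$ have identical adjacency matrices, identical Laplacian matrices, and identical normalized Laplacian matrices.
   Context: A hypergraph $H=(V_H,E_H,w_H)$ consists of a nonempty finite vertex set $V_H$, a finite set $E_H\subseteq 2^{V_H}$ of hyperedges, each of size at least $2$, and a weight function $w_H:E_H\to[0,\infty)$. Hyperedges may have different sizes. A $2$-graph is a hypergraph all of whose hyperedges have size exactly $2$ (a weighted graph without self-loops). The degree of $u$ is $d_H(u)=\sum_{e\in E_H:\,u\in e}w_H(e)$; all degrees are assumed positive. The adjacency matrix is $A_H[u,v]=\sum_{e\in E_H:\{u,v\}\subseteq e}\frac{w_H(e)}{|e|-1}$ for $u\ne v$ and $A_H[u,u]=0$ (for a $2$-graph this is the usual weighted adjacency matrix). $D_H$ is the diagonal matrix of degrees, $L_H=D_H-A_H$ is the Laplacian, and $\mathcal{L}_H=D_H^{-1/2}L_HD_H^{-1/2}$ is the normalized Laplacian; the same definitions apply to the $2$-graph $G_H$. Identity of matrices includes that they are indexed by the same vertex set. *)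

theory Defs
  imports Complex_Main
begin

section \<open>Square matrices indexed by a set\<close>

text \<open>A real matrix whose rows and columns are indexed by a set. The index set is part of the
  matrix and entries outside it are normalised to 0 by \<open>mk_mat\<close>, so that HOL equality means: same
  index set and same entries on it (lemma \<open>mk_mat_eq_iff\<close>).\<close>

record 'a sqmat =
  index :: "'a set"
  entry :: "'a \<Rightarrow> 'a \<Rightarrow> real"

definition mk_mat :: "'a set \<Rightarrow> ('a \<Rightarrow> 'a \<Rightarrow> real) \<Rightarrow> 'a sqmat" where
  "mk_mat V f = \<lparr>index = V, entry = (\<lambda>u v. if u \<in> V \<and> v \<in> V then f u v else 0)\<rparr>"

lemma index_mk_mat [simp]: "index (mk_mat V f) = V"
  by (simp add: mk_mat_def)

lemma entry_mk_mat [simp]: "u \<in> V \<Longrightarrow> v \<in> V \<Longrightarrow> entry (mk_mat V f) u v = f u v"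
  by (simp add: mk_mat_def)

lemma mk_mat_eq_iff:
  "mk_mat V f = mk_mat W g \<longleftrightarrow> V = W \<and> (\<forall>u\<in>V. \<forall>v\<in>V. f u v = g u v)"
  by (auto simp: mk_mat_def fun_eq_iff)

text \<open>Difference and product are only used for matrices over the same finite index set.\<close>

definition mat_diff :: "'a sqmat \<Rightarrow> 'a sqmat \<Rightarrow> 'a sqmat" where
  "mat_diff A B = mk_mat (index A) (\<lambda>u v. entry A u v - entry B u v)"

definition mat_prod :: "'a sqmat \<Rightarrow> 'a sqmat \<Rightarrow> 'a sqmat" where
  "mat_prod A B = mk_mat (index A) (\<lambda>u v. \<Sum>x\<in>index A. entry A u x * entry B x v)"

definition diag_mat :: "'a set \<Rightarrow> ('a \<Rightarrow> real) \<Rightarrow> 'a sqmat" where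
  "diag_mat V d = mk_mat V (\<lambda>u v. if u = v then d u else 0)"


section \<open>Weighted hypergraphs\<close>

text \<open>Only the values of \<open>weight H\<close> on \<open>hedges H\<close> matter.\<close>

record 'a hypergraph =
  verts :: "'a set"
  hedges :: "'a set set"
  weight :: "'a set \<Rightarrow> real"

definition degree :: "'a hypergraph \<Rightarrow> 'a \<Rightarrow> real" where
  "degree H u = (\<Sum>e | e \<in> hedges H \<and> u \<in> e. weight H e)"

text \<open>The standing assumption that all degrees are positive is included here, and hence also
  holds for 2-graphs.\<close>

definition is_hypergraph :: "'a hypergraph \<Rightarrow> bool" where
  "is_hypergraph H \<longleftrightarrow>
     finite (verts H) \<and> verts H \<noteq> {} \<and>
     hedges H \<subseteq> Pow (verts H) \<and>
     (\<forall>e\<in>hedges H. 2 \<le> card e) \<and>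
     (\<forall>e\<in>hedges H. 0 \<le> weight H e) \<and>
     (\<forall>u\<in>verts H. 0 < degree H u)"

definition is_2_graph :: "'a hypergraph \<Rightarrow> bool" where
  "is_2_graph G \<longleftrightarrow> is_hypergraph G \<and> (\<forall>e\<in>hedges G. card e = 2)"

definition adjacency :: "'a hypergraph \<Rightarrow> 'a sqmat" where
  "adjacency H = mk_mat (verts H)
     (\<lambda>u v. if u = v then 0
            else (\<Sum>e | e \<in> hedges H \<and> {u, v} \<subseteq> e. weight H e / (real (card e) - 1)))"

definition degree_mat :: "'a hypergraph \<Rightarrow> 'a sqmat" where
  "degree_mat H = diag_mat (verts H) (degree H)"

definition laplacian :: "'a hypergraph \<Rightarrow> 'a sqmat" where
  "laplacian H = mat_diff (degree_mat H) (adjacency H)"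

text \<open>The inverse square root of the degree matrix, whose diagonal entries are positive.\<close>

definition degree_mat_inv_sqrt :: "'a hypergraph \<Rightarrow> 'a sqmat" where
  "degree_mat_inv_sqrt H = diag_mat (verts H) (\<lambda>u. degree H u powr (- 1 / 2))"

definition normalized_laplacian :: "'a hypergraph \<Rightarrow> 'a sqmat" where
  "normalized_laplacian H =
     mat_prod (mat_prod (degree_mat_inv_sqrt H) (laplacian H)) (degree_mat_inv_sqrt H)"

end

theory Submission
  imports Defs
begin

text \<open>
  The 2-graph is the weighted clique expansion: every hyperedge \<open>e\<close> is replaced by the complete
  graph on its vertices, each of whose edges receives the weight \<open>w e / (|e| - 1)\<close>, and parallel
  edges are merged by adding their weights. An edge of the resulting graph is then the only one
  that contains its two endpoints, so its weight is the corresponding entry of the adjacency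
  matrix, and this weight is by construction the adjacency entry of the hypergraph.

  Everything else follows from the equality of the adjacency matrices, because the degree of a
  vertex is the row sum of the adjacency matrix (\<open>degree_eq_row_sum\<close>): a hyperedge \<open>e\<close> through \<open>u\<close>
  contributes \<open>w e / (|e| - 1)\<close> to the entry of each of the \<open>|e| - 1\<close> other vertices of \<open>e\<close>, in
  total \<open>w e\<close>. Thus the adjacency matrix determines the degrees, and with them both Laplacians.
  Moreover the clique expansion inherits positive degrees from the hypergraph.
\<close>

text \<open>Double counting of the pairs of a hyperedge through \<open>u\<close> and a second vertex in it; the
  normalisation by \<open>|e| - 1\<close> in the adjacency matrix is chosen to make this work. The hypotheses
  are the combinatorial part of \<open>is_hypergraph\<close> alone: the lemma is applied to the clique expansion
  in order to establish that its degrees are positive.\<close>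

lemma degree_eq_row_sum:
  assumes fin: "finite (verts H)" and sub: "hedges H \<subseteq> Pow (verts H)"
    and card2: "\<forall>e\<in>hedges H. 2 \<le> card e" and u: "u \<in> verts H"
  shows "degree H u = (\<Sum>v\<in>verts H. entry (adjacency H) u v)"
proof -
  define c where "c e = weight H e / (real (card e) - 1)" for e
  define E where "E = {e \<in> hedges H. u \<in> e}"
  have finE: "finite E"
    using fin sub unfolding E_def by (auto intro: finite_subset[of _ "Pow (verts H)"])
  have "(\<Sum>v\<in>verts H. entry (adjacency H) u v)
      = (\<Sum>v\<in>verts H. \<Sum>e\<in>E. if v \<in> e - {u} then c e else 0)"
  proof (intro sum.cong refl)
    fix v assume v: "v \<in> verts H"
    have "{e \<in> hedges H. {u, v} \<subseteq> e} = {e \<in> E. v \<in> e}"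
      by (auto simp: E_def)
    then show "entry (adjacency H) u v = (\<Sum>e\<in>E. if v \<in> e - {u} then c e else 0)"
      using u v finE by (simp add: adjacency_def c_def sum.If_cases Int_def conj_commute)
  qed
  also have "\<dots> = (\<Sum>e\<in>E. \<Sum>v\<in>verts H. if v \<in> e - {u} then c e else 0)"
    by (rule sum.swap)
  also have "\<dots> = (\<Sum>e\<in>E. weight H e)"
  proof (intro sum.cong refl)
    fix e assume e: "e \<in> E"
    then have "e \<subseteq> verts H" "u \<in> e" "2 \<le> card e"
      using sub card2 by (auto simp: E_def)
    moreover from this have "verts H \<inter> (e - {u}) = e - {u}"
      by blast
    ultimately have "(\<Sum>v\<in>verts H. if v \<in> e - {u} then c e else 0) = real (card e - 1) * c e"
      using sum.inter_restrict[OF fin, of "\<lambda>_. c e" "e - {u}"] by simp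
    also have "\<dots> = weight H e"
      using \<open>2 \<le> card e\<close> by (simp add: c_def of_nat_diff)
    finally show "(\<Sum>v\<in>verts H. if v \<in> e - {u} then c e else 0) = weight H e" .
  qed
  finally show ?thesis
    by (simp add: degree_def E_def)
qed

text \<open>All pairs of vertices are edges, those that lie in no common hyperedge with weight 0 (the
  empty sum), so that every pair is treated alike.\<close>

definition clique_expansion :: "'a hypergraph \<Rightarrow> 'a hypergraph" where
  "clique_expansion H =
     \<lparr>verts = verts H,
      hedges = {p. p \<subseteq> verts H \<and> card p = 2},
      weight = (\<lambda>p. \<Sum>e | e \<in> hedges H \<and> p \<subseteq> e. weight H e / (real (card e) - 1))\<rparr>"

lemma verts_clique_expansion [simp]: "verts (clique_expansion H) = verts H"
  by (simp add: clique_expansion_def)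

text \<open>For distinct vertices the sum defining the adjacency entry of the clique expansion has a
  single term, that of the edge \<open>{u, v}\<close>, whose denominator is 1.\<close>

lemma adjacency_clique_expansion: "adjacency (clique_expansion H) = adjacency H"
proof -
  have "{p. p \<subseteq> verts H \<and> card p = 2 \<and> {u, v} \<subseteq> p} = {{u, v}}"
    if "u \<in> verts H" "v \<in> verts H" "u \<noteq> v" for u v
    using that by (auto simp: card_2_iff)
  then show ?thesis
    by (simp add: adjacency_def clique_expansion_def mk_mat_eq_iff conj_assoc del: insert_subset)
qed

lemma degree_clique_expansion:
  assumes "is_hypergraph H" "u \<in> verts H"
  shows "degree (clique_expansion H) u = degree H u"
proof -
  have "degree (clique_expansion H) u
      = (\<Sum>v\<in>verts H. entry (adjacency (clique_expansion H)) u v)"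
    using assms degree_eq_row_sum[of "clique_expansion H" u]
    by (auto simp: is_hypergraph_def clique_expansion_def)
  also have "\<dots> = degree H u"
    using assms degree_eq_row_sum[of H u]
    by (simp add: adjacency_clique_expansion is_hypergraph_def)
  finally show ?thesis .
qed

lemma is_2_graph_clique_expansion:
  assumes "is_hypergraph H"
  shows "is_2_graph (clique_expansion H)"
proof -
  have "0 \<le> weight (clique_expansion H) p" for p
    using assms unfolding clique_expansion_def is_hypergraph_def
    by (fastforce intro!: sum_nonneg divide_nonneg_nonneg)
  moreover have "\<forall>u\<in>verts H. 0 < degree (clique_expansion H) u"
    using assms by (simp add: degree_clique_expansion is_hypergraph_def)
  moreover have "hedges (clique_expansion H) = {p. p \<subseteq> verts H \<and> card p = 2}"
    by (simp add: clique_expansion_def)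
  ultimately show ?thesis
    using assms by (auto simp: is_2_graph_def is_hypergraph_def)
qed

theorem lemma3p3:
  fixes H :: "'a hypergraph"
  assumes "is_hypergraph H"
  shows "\<exists>G :: 'a hypergraph. is_2_graph G \<and>
           adjacency H = adjacency G \<and>
           laplacian H = laplacian G \<and>
           normalized_laplacian H = normalized_laplacian G"
proof -
  let ?G = "clique_expansion H"
  have deg: "degree_mat H = degree_mat ?G"
    "degree_mat_inv_sqrt H = degree_mat_inv_sqrt ?G"
    using assms
    by (simp_all add: degree_mat_def degree_mat_inv_sqrt_def diag_mat_def mk_mat_eq_iff
        degree_clique_expansion)
  have lap: "laplacian H = laplacian ?G"
    by (simp add: laplacian_def deg adjacency_clique_expansion)
  then have "normalized_laplacian H = normalized_laplacian ?G"
    by (simp add: normalized_laplacian_def deg)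
  with assms lap show ?thesis
    using is_2_graph_clique_expansion adjacency_clique_expansion by metis
qed

end
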